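(* Let $X$ be a real random variable that is log-concave (with respect to Lebesgue measure), let $U$ be uniform on an interval and let $Z$ be exponentially distributed, with parameters determined by $M(U)=M(X)=M(Z)$. Then for every Young function $\psi$, $$\|U-\mathbb{E}U\|_\psi\le\|X-\mathbb{E}X\|_\psi\le\|Z-\mathbb{E}Z\|_\psi .$$
   Context: A function $f:\mathbb{R}\to[0,\infty)$ is log-concave if $f((1-s)x+sy)\ge f(x)^{1-s}f(y)^s$ for all $x,y\in\mathbb{R}$, $s\in[0,1]$. A real random variable is log-concave (with respect to Lebesgue measure) if it has a density with respect to Lebesgue measure that is almost everywhere equal to a log-concave function. For a random variable $W$ with Lebesgue density $f$, $M(W)$ denotes the essential supremum of $f$ with respect to Lebesgue measure. (Thus $U$ is uniform on an interval of length $1/M(X)$, and $Z$ has density $M(X)e^{-M(X)x}$ on $(0,\infty)$.) A Young function is a function $\psi:[0,\infty)\to[0,\infty)$ that is strictly increasing and convex with $\psi(0)=0$. The $\psi$-Orlicz norm of $W$ is $\|W\|_\psi=\inf\{t>0:\mathbb{E}\,\psi(|W|/t)\le 1\}$, with $\inf\emptyset=+\infty$. *)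

theory Defs
  imports "HOL-Probability.Probability"
begin

(* The library has 0 powr 0 = 0, not 1. This only concerns s = 0 and s = 1, where the
   inequality is trivial under either convention. *)
definition log_concave :: "(real \<Rightarrow> real) \<Rightarrow> bool" where
  "log_concave f \<longleftrightarrow> (\<forall>x. 0 \<le> f x) \<and>
     (\<forall>x y. \<forall>s\<in>{0..1}. f ((1 - s) * x + s * y) \<ge> f x powr (1 - s) * f y powr s)"

definition log_concave_rv :: "'a measure \<Rightarrow> ('a \<Rightarrow> real) \<Rightarrow> bool" where
  "log_concave_rv M X \<longleftrightarrow>
     (\<exists>g f. distributed M lborel X g \<and> log_concave f \<and> (AE x in lborel. g x = ennreal (f x)))"

(* The functional M(W). A Lebesgue density of W is unique up to null sets, so the choice made by
   RN_deriv does not affect the essential supremum. Only meaningful if W has a Lebesgue density: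
   otherwise RN_deriv is 0 by convention. *)
definition max_density :: "'a measure \<Rightarrow> ('a \<Rightarrow> real) \<Rightarrow> ennreal" where
  "max_density M W = esssup lborel (RN_deriv lborel (distr M lborel W))"

(* Functions on [0, oo) are total functions on the reals, whose values at negative arguments
   are irrelevant. *)
definition young_function :: "(real \<Rightarrow> real) \<Rightarrow> bool" where
  "young_function \<psi> \<longleftrightarrow>
     \<psi> \<in> {0..} \<rightarrow> {0..} \<and> strict_mono_on {0..} \<psi> \<and> convex_on {0..} \<psi> \<and> \<psi> 0 = 0"

(* The expectation may be infinite, hence the nonnegative integral; in ennreal, Inf {} = top. *)
definition orlicz_norm :: "(real \<Rightarrow> real) \<Rightarrow> 'a measure \<Rightarrow> ('a \<Rightarrow> real) \<Rightarrow> ennreal" where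
  "orlicz_norm \<psi> M W =
     Inf {ennreal t | t. 0 < t \<and> (\<integral>\<^sup>+ \<omega>. ennreal (\<psi> (\<bar>W \<omega>\<bar> / t)) \<partial>M) \<le> 1}"

end

theory Submission
  imports Defs
begin

text \<open>
  Both bounds hold for the expectation of every function \<open>\<phi> x = \<psi> (\<bar>x\<bar> / t)\<close>, which is convex, even and
  nonnegative; the Orlicz norms then compare because their defining sets are nested.

  Lower bound. Among all laws with density at most \<open>m\<close>, the mass can be packed closest to a given
  point by spreading it with density \<open>m\<close> over the interval of length \<open>1 / m\<close> around the point, and \<open>\<phi>\<close>
  grows with the distance (\<open>bounded_density_integral_ge_uniform\<close>).

  Upper bound. Let \<open>l\<close> be the peak of the density \<open>f\<close> of \<open>X\<close>, let \<open>F\<close> be its distribution function and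
  \<open>p\<close> the mass to the left of the mode. Log-concavity makes \<open>f / F\<close> nonincreasing and
  \<open>f / (1 - F)\<close> nondecreasing. Hence \<open>F\<close> grows at rate at least \<open>l / p\<close> to the left of the mode and
  \<open>1 - F\<close> decays at rate at least \<open>l / (1 - p)\<close> to its right. An asymmetric Laplace law with peak \<open>l\<close> and mass \<open>p\<close>
  on the left has exactly these rates, so the monotone map \<open>r\<close> that carries \<open>X\<close> to a variable with
  that law expands distances (\<open>laplace_transport_expands\<close>). An expanding map can
  only increase the expectation of a convex function of the centered variable
  (\<open>centered_convex_le_of_expansion\<close>).

  It remains to compare \<open>r X\<close> with the exponential variable \<open>Z\<close>. If \<open>Z\<close> and \<open>Z'\<close> are independent
  with rate \<open>l\<close>, then \<open>(1 - p) Z - p Z'\<close> has precisely the asymmetric Laplace law of \<open>r X\<close>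
  (\<open>exponential_difference_cdf\<close>). Its centering is a convex combination of the centered variable \<open>Z\<close>
  and the negative of the centered variable \<open>Z'\<close>, so convexity and evenness of \<open>\<phi>\<close> give the bound (\<open>centered_exponential_difference_le\<close>).
\<close>

section \<open>Log-concave functions on the line\<close>

lemma log_concave_nonneg: "log_concave f \<Longrightarrow> 0 \<le> f x"
  by (simp add: log_concave_def)

text \<open>The points \<^term>\<open>x\<close> and \<^term>\<open>y - d\<close> lie between \<^term>\<open>x - d\<close> and \<^term>\<open>y\<close> and
  divide that interval in complementary proportions, so the two log-concavity inequalities
  multiply to this one. This is the form in which log-concavity enters the proof.\<close>

lemma log_concave_four_points:
  assumes f: "log_concave f" and "x \<le> y" "0 \<le> d"
  shows "f (x - d) * f y \<le> f x * f (y - d)"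
proof (cases "x - d = y \<or> f (x - d) = 0 \<or> f y = 0")
  case True
  then show ?thesis using assms log_concave_nonneg[OF f] by (auto simp: mult.commute)
next
  case False
  define D where "D = y - x + d"
  define s where "s = d / D"
  have D: "D > 0" using False assms by (auto simp: D_def)
  have s: "s \<in> {0..1}" "1 - s \<in> {0..1}" using D assms by (auto simp: s_def D_def field_simps)
  have pos: "0 < f (x - d)" "0 < f y"
    using False log_concave_nonneg[OF f, of "x - d"] log_concave_nonneg[OF f, of y] by auto
  have sD: "s * D = d" using D by (simp add: s_def)
  have "(1 - s) * (x - d) + s * y = x" "s * (x - d) + (1 - s) * y = y - d"
    using sD by (auto simp: D_def algebra_simps)
  moreover have "f (x - d) powr (1 - s') * f y powr s' \<le> f ((1 - s') * (x - d) + s' * y)" if "s' \<in> {0..1}" for s'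
    using f that unfolding log_concave_def by blast
  from this[OF s(1)] this[OF s(2)]
  have "f (x - d) powr (1 - s) * f y powr s \<le> f ((1 - s) * (x - d) + s * y)"
    "f (x - d) powr s * f y powr (1 - s) \<le> f (s * (x - d) + (1 - s) * y)"
    by simp_all
  ultimately have le: "f (x - d) powr (1 - s) * f y powr s \<le> f x"
    "f (x - d) powr s * f y powr (1 - s) \<le> f (y - d)"
    by simp_all
  have "f (x - d) * f y = (f (x - d) powr (1 - s) * f (x - d) powr s) * (f y powr s * f y powr (1 - s))"
    using pos by (simp flip: powr_add)
  also have "\<dots> = (f (x - d) powr (1 - s) * f y powr s) * (f (x - d) powr s * f y powr (1 - s))"
    by (simp only: mult_ac)
  also have "\<dots> \<le> f x * f (y - d)"
    using le by (intro mult_mono) (auto simp: log_concave_nonneg[OF f])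
  finally show ?thesis .
qed

lemma convex_log_concave_superlevel:
  assumes "log_concave f" "0 \<le> c"
  shows "convex {x. c < f x}"
proof (rule convexI, clarify)
  fix x y u v :: real
  assume *: "c < f x" "c < f y" "0 \<le> u" "0 \<le> v" "u + v = 1"
  have "min (f x) (f y) = min (f x) (f y) powr (u + v)"
    using * assms by (simp add: min_def)
  also have "\<dots> = min (f x) (f y) powr u * min (f x) (f y) powr v"
    by (rule powr_add)
  also have "\<dots> \<le> f x powr u * f y powr v"
    using * assms(2) by (intro mult_mono powr_mono2) auto
  also have "\<dots> \<le> f (u *\<^sub>R x + v *\<^sub>R y)"
  proof -
    have "u = 1 - v" "v \<in> {0..1}" using * by auto
    then show ?thesis using assms(1) unfolding log_concave_def by simp
  qed
  finally show "c < f (u *\<^sub>R x + v *\<^sub>R y)" using * by (auto simp: min_def split: if_splits)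
qed

text \<open>The superlevel sets are intervals.\<close>

lemma borel_measurable_log_concave:
  assumes "log_concave f"
  shows "f \<in> borel_measurable borel"
proof (rule borel_measurableI_greater)
  fix c :: real
  have "{x. c < f x} \<in> sets borel"
  proof (cases "0 \<le> c")
    case True
    then have "is_interval {x. c < f x}"
      using convex_log_concave_superlevel[OF assms] is_interval_convex_1 by blast
    from is_real_interval[OF this] show ?thesis by (elim exE disjE) simp_all
  next
    case False
    then have "c < f x" for x using log_concave_nonneg[OF assms, of x] by linarith
    then show ?thesis by simp
  qed
  then show "{x \<in> space borel. c < f x} \<in> sets borel" by simp
qed

lemma log_concave_uminus:
  assumes "log_concave f"
  shows "log_concave (\<lambda>x. f (- x))"
  unfolding log_concave_def
proof (intro conjI allI ballI)
  fix x y s :: real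
  assume "s \<in> {0..1}"
  then have "f (- x) powr (1 - s) * f (- y) powr s \<le> f ((1 - s) * (- x) + s * (- y))"
    using assms unfolding log_concave_def by blast
  also have "(1 - s) * (- x) + s * (- y) = - ((1 - s) * x + s * y)" by (simp add: algebra_simps)
  finally show "f (- x) powr (1 - s) * f (- y) powr s \<le> f (- ((1 - s) * x + s * y))" .
qed (rule log_concave_nonneg[OF assms])

lemma nn_integral_real_shift:
  assumes "f \<in> borel_measurable borel"
  shows "(\<integral>\<^sup>+x. f (x + t) \<partial>lborel) = (\<integral>\<^sup>+x. f (x::real) \<partial>lborel)"
  using nn_integral_real_affine[of f 1 t] assms by (simp add: add.commute)

section \<open>The distribution function of a log-concave law\<close>

text \<open>A Gronwall inequality for finite increments: over \<open>n\<close> equal subintervals, the hypothesis gives a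
  factor \<open>(1 + c * (v - u) / n) ^ n\<close>, which tends to the exponential.\<close>

lemma exp_growth_of_linear_increments:
  fixes F :: "real \<Rightarrow> real"
  assumes step: "\<And>s t. u \<le> s \<Longrightarrow> s \<le> t \<Longrightarrow> t \<le> v \<Longrightarrow> F s * (1 + c * (t - s)) \<le> F t"
    and "0 \<le> c" "u \<le> v"
  shows "F u * exp (c * (v - u)) \<le> F v"
proof -
  define d where "d = v - u"
  have d: "0 \<le> d" using assms by (simp add: d_def)
  have subdivide: "F u * (1 + c * d / n) ^ k \<le> F (u + k * (d / n))" if "k \<le> n" "0 < n" for k n :: nat
    using that(1)
  proof (induction k)
    case (Suc k)
    have "real (Suc k) * (d / n) \<le> n * (d / n)"
      using Suc.prems d by (intro mult_right_mono) auto
    then have le: "u + Suc k * (d / n) \<le> v" using that(2) by (simp add: d_def)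
    have "F u * (1 + c * d / n) ^ Suc k = F u * (1 + c * d / n) ^ k * (1 + c * (d / n))" by simp
    also have "\<dots> \<le> F (u + k * (d / n)) * (1 + c * (d / n))"
      using Suc d assms(2) by (intro mult_right_mono) auto
    also have "\<dots> = F (u + k * (d / n)) * (1 + c * ((u + Suc k * (d / n)) - (u + k * (d / n))))"
      by (simp add: algebra_simps add_divide_distrib)
    also have "\<dots> \<le> F (u + Suc k * (d / n))"
    proof (rule step[OF _ _ le])
      show "u \<le> u + k * (d / n)" using d by simp
      show "u + k * (d / n) \<le> u + Suc k * (d / n)"
        using d by (intro add_left_mono mult_right_mono) auto
    qed
    finally show ?case .
  qed simp
  have "F u * (1 + c * d / n) ^ n \<le> F v" if "1 \<le> n" for n :: nat
    using subdivide[of n n] that by (simp add: d_def)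
  moreover have "(\<lambda>n. F u * (1 + c * d / n) ^ n) \<longlonglongrightarrow> F u * exp (c * d)"
    by (intro tendsto_mult tendsto_const tendsto_exp_limit_sequentially)
  ultimately show ?thesis
    unfolding d_def by (intro LIMSEQ_le_const2) auto
qed

text \<open>The last assumption says that the supremum of the density is at least \<^term>\<open>l\<close>. It speaks of numbers
  below \<^term>\<open>l\<close> because a log-concave density may jump down at its mode.\<close>

locale log_concave_law =
  fixes f :: "real \<Rightarrow> real" and l :: real
  assumes lc: "log_concave f"
    and prob: "prob_space (density lborel f)"
    and l_pos: "0 < l"
    and density_exceeds: "\<And>c. c < l \<Longrightarrow> \<exists>x. c < f x"
begin

abbreviation "\<nu> \<equiv> density lborel (\<lambda>x. ennreal (f x))"
abbreviation "F \<equiv> cdf \<nu>"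

lemma f_meas[measurable]: "f \<in> borel_measurable borel"
  by (rule borel_measurable_log_concave[OF lc])

lemma f_nonneg: "0 \<le> f x" by (rule log_concave_nonneg[OF lc])

lemma real_distribution_law: "real_distribution \<nu>"
proof -
  interpret prob_space \<nu> by (rule prob)
  show ?thesis by unfold_locales auto
qed

sublocale real_distribution \<nu> by (rule real_distribution_law)

lemma emeasure_law: "A \<in> sets borel \<Longrightarrow> ennreal (measure \<nu> A) = (\<integral>\<^sup>+x. ennreal (f x) * indicator A x \<partial>lborel)"
  by (simp add: emeasure_eq_measure[symmetric] emeasure_density)

lemma measure_singleton: "measure \<nu> {x} = 0"
proof -
  have "AE y in lborel. ennreal (f y) * indicator {x} y = 0"
    using AE_lborel_singleton[of x] by eventually_elim simp
  then have "(\<integral>\<^sup>+y. ennreal (f y) * indicator {x} y \<partial>lborel) = 0"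
    by (subst nn_integral_0_iff_AE) simp_all
  then show ?thesis using emeasure_law[of "{x}"] by simp
qed

lemma isCont_F: "isCont F x" by (simp add: isCont_cdf measure_singleton)

lemma F_at_left: "(F \<longlongrightarrow> F x) (at_left x)"
  using isCont_F[of x] by (simp add: isCont_def filterlim_at_split)

text \<open>The distribution function inherits log-concavity: the reversed hazard rate \<open>f / F\<close> is
  nonincreasing. The four point inequality holds between the integrands.\<close>

lemma F_mult_le:
  assumes "w \<le> z"
  shows "F w * f z \<le> f w * F z"
proof -
  have "ennreal (F w * f z) = (\<integral>\<^sup>+x. ennreal (f x) * indicator {..w} x \<partial>lborel) * ennreal (f z)"
    using emeasure_law[of "{..w}"] by (simp add: cdf_def ennreal_mult f_nonneg)
  also have "\<dots> = (\<integral>\<^sup>+x. ennreal (f x) * indicator {..w} x * ennreal (f z) \<partial>lborel)"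
    by (rule nn_integral_multc[symmetric]) simp
  also have "\<dots> = (\<integral>\<^sup>+x. ennreal (f (x + (w - z))) * indicator {..w} (x + (w - z)) * ennreal (f z) \<partial>lborel)"
    by (rule nn_integral_real_shift[symmetric]) simp
  also have "\<dots> \<le> (\<integral>\<^sup>+x. ennreal (f w) * (ennreal (f x) * indicator {..z} x) \<partial>lborel)"
  proof (rule nn_integral_mono)
    fix x
    have "f (x - (z - w)) * f z \<le> f x * f (z - (z - w))" if "x \<le> z"
      by (rule log_concave_four_points[OF lc that]) (use assms in simp)
    then show "ennreal (f (x + (w - z))) * indicator {..w} (x + (w - z)) * ennreal (f z)
        \<le> ennreal (f w) * (ennreal (f x) * indicator {..z} x)"
      by (auto simp: f_nonneg ennreal_mult'[symmetric] algebra_simps split: split_indicator)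
  qed
  also have "\<dots> = ennreal (f w) * (\<integral>\<^sup>+x. ennreal (f x) * indicator {..z} x \<partial>lborel)"
    by (rule nn_integral_cmult) simp
  also have "\<dots> = ennreal (f w * F z)"
    using emeasure_law[of "{..z}"] by (simp add: cdf_def ennreal_mult f_nonneg)
  finally show ?thesis by (simp add: f_nonneg cdf_nonneg)
qed

text \<open>Integrated form of the bound \<open>f x \<ge> F x * f z / F z\<close> from the monotonicity of \<open>f / F\<close>; it avoids
  derivatives of \<^term>\<open>F\<close> at points where \<^term>\<open>f\<close> may be discontinuous.\<close>

lemma F_increment_ge:
  assumes "u \<le> v" "v \<le> z"
  shows "f z * F u * (v - u) \<le> (F v - F u) * F z"
proof (cases "u = v")
  case False
  have "ennreal (f z * F u * (v - u)) = (\<integral>\<^sup>+x. ennreal (F u * f z) * indicator {u<..v} x \<partial>lborel)"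
    using assms by (subst nn_integral_cmult_indicator)
      (auto simp: ennreal_mult'[symmetric] f_nonneg cdf_nonneg mult.commute)
  also have "\<dots> \<le> (\<integral>\<^sup>+x. ennreal (F z) * (ennreal (f x) * indicator {u<..v} x) \<partial>lborel)"
  proof (rule nn_integral_mono)
    fix x
    have "F u * f z \<le> F z * f x" if "u < x" "x \<le> v"
    proof -
      have "F u * f z \<le> F x * f z" using that by (intro mult_right_mono cdf_nondecreasing f_nonneg) simp
      also have "\<dots> \<le> f x * F z" using that assms by (intro F_mult_le) simp
      finally show ?thesis by (simp add: mult.commute)
    qed
    then show "ennreal (F u * f z) * indicator {u<..v} x \<le> ennreal (F z) * (ennreal (f x) * indicator {u<..v} x)"
      by (auto simp: f_nonneg cdf_nonneg ennreal_mult'[symmetric] split: split_indicator)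
  qed
  also have "\<dots> = ennreal (F z) * (\<integral>\<^sup>+x. ennreal (f x) * indicator {u<..v} x \<partial>lborel)"
    by (rule nn_integral_cmult) simp
  also have "\<dots> = ennreal (F z * (F v - F u))"
    using emeasure_law[of "{u<..v}"] cdf_diff_eq[of u v] assms False
    by (simp add: ennreal_mult f_nonneg cdf_nonneg)
  finally show ?thesis
    by (subst (asm) ennreal_le_iff) (use assms in \<open>auto simp: cdf_nonneg cdf_nondecreasing mult.commute\<close>)
qed simp

text \<open>The density exceeds \<open>l / 2\<close> on the whole segment between the two points, which carries mass at
  most 1.\<close>

lemma bounded_superlevel:
  assumes "l / 2 < f x" "l / 2 < f y"
  shows "\<bar>y - x\<bar> \<le> 2 / l"
  using assms
proof (induction x y rule: linorder_wlog)
  case (le x y)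
  have "ennreal (l / 2 * (y - x)) = (\<integral>\<^sup>+t. ennreal (l / 2) * indicator {x..y} t \<partial>lborel)"
    using l_pos le by (subst nn_integral_cmult_indicator) (auto simp: ennreal_mult'[symmetric])
  also have "\<dots> \<le> (\<integral>\<^sup>+t. ennreal (f t) * indicator {x..y} t \<partial>lborel)"
  proof (rule nn_integral_mono)
    fix t
    have "l / 2 \<le> f t" if "t \<in> {x..y}"
    proof -
      have "convex {x. l / 2 < f x}"
        using l_pos by (intro convex_log_concave_superlevel lc) auto
      then have "closed_segment x y \<subseteq> {x. l / 2 < f x}"
        using le by (intro closed_segment_subset) auto
      then show ?thesis using that le by (auto simp: closed_segment_eq_real_ivl intro: less_imp_le)
    qed
    then show "ennreal (l / 2) * indicator {x..y} t \<le> ennreal (f t) * indicator {x..y} t"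
      by (auto split: split_indicator intro!: ennreal_leI dest: less_imp_le)
  qed
  also have "\<dots> = ennreal (measure \<nu> {x..y})"
    by (rule emeasure_law[symmetric]) simp
  finally have "l / 2 * (y - x) \<le> measure \<nu> {x..y}" by (simp)
  also have "\<dots> \<le> 1" by simp
  finally show ?case using l_pos le by (simp add: field_simps)
qed (simp add: abs_minus_commute)

text \<open>If \<^term>\<open>l\<close> is the supremum of the density, then \<open>x0\<close> is a mode, up to the value of the density at
  that single point.\<close>

lemma sequence_approaching_level:
  obtains X x0 where "X \<longlonglongrightarrow> x0" "\<And>n. l - l / (real n + 2) < f (X n)"
proof -
  \<comment> \<open>The offset 2 keeps all the bounds at or above \<open>l / 2\<close>.\<close>
  have "\<exists>x. l - l / (real n + 2) < f x" for n
    by (rule density_exceeds) (use l_pos in auto)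
  then obtain Y :: "nat \<Rightarrow> real" where Y: "\<And>n. l - l / (real n + 2) < f (Y n)" by metis
  have "l / 2 < f (Y n)" for n :: nat
  proof -
    have "l / (real n + 2) \<le> l / 2" using l_pos by (intro divide_left_mono) auto
    then show ?thesis using Y[of n] by linarith
  qed
  then have near: "\<bar>Y n - Y 0\<bar> \<le> 2 / l" for n by (intro bounded_superlevel)
  have "norm (Y n) \<le> \<bar>Y 0\<bar> + 2 / l" for n
    using near[of n] unfolding real_norm_def by linarith
  then have "bounded (range Y)" by (auto simp: bounded_iff)
  then obtain x0 r where r: "strict_mono (r :: nat \<Rightarrow> nat)" "(Y \<circ> r) \<longlonglongrightarrow> x0"
    using bounded_imp_convergent_subsequence by blast
  have "l - l / (real n + 2) < f (Y (r n))" for n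
  proof -
    have "l / (real (r n) + 2) \<le> l / (real n + 2)"
      using l_pos seq_suble[OF r(1), of n] by (intro divide_left_mono) auto
    then show ?thesis using Y[of "r n"] by linarith
  qed
  with r(2) that[of "Y \<circ> r" x0] show ?thesis by simp
qed

end

context log_concave_law
begin

text \<open>To the left of each point \<open>z = X n\<close>, the reversed hazard rate \<open>f / F\<close> is at least \<open>f z / F z\<close>, which
  in the limit is at least \<open>l / F x0\<close>. The resulting estimate of increments holds below \<open>x0\<close>, and by
  continuity of \<^term>\<open>F\<close> up to \<open>x0\<close>.\<close>

lemma F_exp_growth:
  assumes X: "X \<longlonglongrightarrow> x0" "\<And>n. l - l / (real n + 2) < f (X n)" and uv: "u \<le> v" "v \<le> x0"
  shows "F u * exp (l / F x0 * (v - u)) \<le> F v"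
proof (cases "F u = 0")
  case True
  then show ?thesis by (simp add: cdf_nonneg)
next
  case False
  have FX: "(\<lambda>n. F (X n)) \<longlonglongrightarrow> F x0"
    by (rule isCont_tendsto_compose[OF isCont_F X(1)])
  have lX: "(\<lambda>n. l - l / (real n + 2)) \<longlonglongrightarrow> l"
    by real_asymp
  have below: "l * F s * (t - s) \<le> (F t - F s) * F x0" if "s \<le> t" "t < x0" for s t
  proof (rule tendsto_le[OF sequentially_bot])
    show "(\<lambda>n. (l - l / (real n + 2)) * F s * (t - s)) \<longlonglongrightarrow> l * F s * (t - s)"
      by (intro tendsto_intros lX)
    show "(\<lambda>n. (F t - F s) * F (X n)) \<longlonglongrightarrow> (F t - F s) * F x0"
      by (intro tendsto_intros FX)
    show "\<forall>\<^sub>F n in sequentially. (l - l / (real n + 2)) * F s * (t - s) \<le> (F t - F s) * F (X n)"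
      using order_tendstoD(1)[OF X(1) that(2)]
    proof eventually_elim
      case (elim n)
      have "(l - l / (real n + 2)) * F s * (t - s) \<le> f (X n) * F s * (t - s)"
        using X(2)[of n] that by (intro mult_right_mono) (auto simp: cdf_nonneg)
      also have "\<dots> \<le> (F t - F s) * F (X n)"
        using that elim by (intro F_increment_ge) auto
      finally show ?case .
    qed
  qed
  have upto: "l * F s * (t - s) \<le> (F t - F s) * F x0" if "s \<le> t" "t \<le> x0" for s t
  proof (cases "s = t")
    case False
    then have "s < t" using that by simp
    show ?thesis
    proof (rule tendsto_le[OF trivial_limit_at_left_real[of t]])
      have "(F \<longlongrightarrow> F t) (at_left t)"
        by (rule F_at_left)
      then show "((\<lambda>t. (F t - F s) * F x0) \<longlongrightarrow> (F t - F s) * F x0) (at_left t)"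
        by (intro tendsto_intros)
      show "((\<lambda>t. l * F s * (t - s)) \<longlongrightarrow> l * F s * (t - s)) (at_left t)"
        by (intro tendsto_intros)
      show "\<forall>\<^sub>F t in at_left t. l * F s * (t - s) \<le> (F t - F s) * F x0"
        using eventually_at_left_real[OF \<open>s < t\<close>]
        by eventually_elim (use that in \<open>auto intro!: below\<close>)
    qed
  qed simp
  have "0 < F u" using False cdf_nonneg[of u] by simp
  also have "F u \<le> F x0" using uv by (intro cdf_nondecreasing) simp
  finally have pos: "0 < F x0" .
  show ?thesis
  proof (rule exp_growth_of_linear_increments)
    fix s t assume st: "u \<le> s" "s \<le> t" "t \<le> v"
    have "l * F s * (t - s) \<le> (F t - F s) * F x0" using st uv by (intro upto) auto
    then show "F s * (1 + l / F x0 * (t - s)) \<le> F t" using pos by (simp add: field_simps)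
  qed (use l_pos pos uv in auto)
qed

lemma reflected: "log_concave_law (\<lambda>x. f (- x)) l"
proof (rule log_concave_law.intro)
  show "log_concave (\<lambda>x. f (- x))" by (rule log_concave_uminus[OF lc])
  have "(\<integral>\<^sup>+x. ennreal (f (- x)) \<partial>lborel) = (\<integral>\<^sup>+x. ennreal (f x) \<partial>lborel)"
    using nn_integral_real_affine[of "\<lambda>x. ennreal (f x)" "-1" 0] by simp
  also have "\<dots> = emeasure \<nu> (space \<nu>)" by (simp add: emeasure_density)
  also have "\<dots> = 1" by (rule emeasure_space_1)
  finally show "prob_space (density lborel (\<lambda>x. ennreal (f (- x))))"
    by (intro prob_spaceI) (simp add: emeasure_density)
  show "0 < l" by (rule l_pos)
  show "\<exists>x. c < f (- x)" if "c < l" for c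
    using density_exceeds[OF that] by (metis minus_minus)
qed

lemma cdf_reflected: "cdf (density lborel (\<lambda>x. ennreal (f (- x)))) x = 1 - F (- x)"
proof -
  have "ennreal (cdf (density lborel (\<lambda>x. ennreal (f (- x)))) x) = (\<integral>\<^sup>+y. ennreal (f (- y)) * indicator {..x} y \<partial>lborel)"
    unfolding cdf_def by (rule log_concave_law.emeasure_law[OF reflected]) simp
  also have "\<dots> = (\<integral>\<^sup>+y. ennreal (f y) * indicator {- x..} y \<partial>lborel)"
    using nn_integral_real_affine[of "\<lambda>x'. ennreal (f x') * indicator {- x..} x'" "-1" 0]
    by (simp add: indicator_def)
  also have "\<dots> = ennreal (measure \<nu> {- x..})" by (rule emeasure_law[symmetric]) simp
  finally have "cdf (density lborel (\<lambda>x. ennreal (f (- x)))) x = measure \<nu> {- x..}"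
    by (simp add: cdf_def)
  also have "{- x..} = space \<nu> - {..< - x}" by auto
  also have "measure \<nu> \<dots> = 1 - measure \<nu> {..< - x}" by (rule prob_compl) simp
  also have "measure \<nu> {..< - x} = F (- x)"
    by (rule tendsto_unique[OF trivial_limit_at_left_real cdf_at_left F_at_left])
  finally show ?thesis .
qed

text \<open>The mirror image of the growth to the left of \<open>x0\<close>.\<close>

lemma survival_exp_decay:
  assumes X: "X \<longlonglongrightarrow> x0" "\<And>n. l - l / (real n + 2) < f (X n)" and uv: "x0 \<le> u" "u \<le> v"
  shows "(1 - F v) * exp (l / (1 - F x0) * (v - u)) \<le> 1 - F u"
  using log_concave_law.F_exp_growth[OF reflected, of "\<lambda>n. - X n" "- x0" "- v" "- u"] assms
  by (simp add: cdf_reflected tendsto_minus)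

end

section \<open>Expansion onto an asymmetric Laplace law\<close>

text \<open>The distribution function of the density with peak \<^term>\<open>l\<close> at 0 and exponential tails that carry
  mass \<^term>\<open>p\<close> on the left and \<open>1 - p\<close> on the right, that is, with \<open>exp (l * y / p)\<close> and
  \<open>exp (- l * y / (1 - p))\<close> as tail profiles. As \<open>x / 0 = 0\<close>, the formula is also correct for the
  one-sided cases \<open>p = 0\<close> and \<open>p = 1\<close>, where a density formula would need a case distinction.\<close>

definition laplace_cdf :: "real \<Rightarrow> real \<Rightarrow> real \<Rightarrow> real" where
  "laplace_cdf l p y = (if y < 0 then p * exp (l * y / p) else 1 - (1 - p) * exp (- l * y / (1 - p)))"

definition laplace_quantile :: "real \<Rightarrow> real \<Rightarrow> real \<Rightarrow> real" where
  "laplace_quantile l p v = (if v \<le> p then p / l * ln (v / p) else - ((1 - p) / l) * ln ((1 - v) / (1 - p)))"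

lemma laplace_quantile_le_iff:
  assumes "0 < l" "0 \<le> p" "p \<le> 1" "0 < v" "v < 1"
  shows "laplace_quantile l p v \<le> y \<longleftrightarrow> v \<le> laplace_cdf l p y"
proof (cases "v \<le> p")
  case True
  then have p: "0 < p" using assms by simp
  have q: "laplace_quantile l p v = p / l * ln (v / p)" using True by (simp add: laplace_quantile_def)
  show ?thesis
  proof (cases "y < 0")
    case y: True
    have "p / l * ln (v / p) \<le> y \<longleftrightarrow> ln (v / p) \<le> l * y / p"
      using assms p by (simp add: field_simps)
    also have "\<dots> \<longleftrightarrow> v / p \<le> exp (l * y / p)"
      using assms p by (metis divide_pos_pos exp_le_cancel_iff exp_ln)
    also have "\<dots> \<longleftrightarrow> v \<le> p * exp (l * y / p)" using p by (simp add: field_simps)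
    finally show ?thesis using y by (simp add: q laplace_cdf_def)
  next
    case y: False
    have "p / l * ln (v / p) \<le> 0" using True p assms by (intro mult_nonneg_nonpos) auto
    moreover have "(1 - p) * exp (- l * y / (1 - p)) \<le> (1 - p) * 1"
      using assms y by (intro mult_left_mono) auto
    ultimately show ?thesis using True y by (auto simp: q laplace_cdf_def)
  qed
next
  case False
  then have p: "p < 1" using assms by simp
  have q: "laplace_quantile l p v = - ((1 - p) / l) * ln ((1 - v) / (1 - p))"
    using False by (simp add: laplace_quantile_def)
  show ?thesis
  proof (cases "y < 0")
    case y: True
    have "0 \<le> - ((1 - p) / l) * ln ((1 - v) / (1 - p))"
      using False p assms by (intro mult_nonpos_nonpos) auto
    moreover have "p * exp (l * y / p) \<le> p * 1"
      using assms y by (intro mult_left_mono) (auto simp: divide_nonpos_nonneg mult_nonneg_nonpos)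
    ultimately show ?thesis using False y by (auto simp: q laplace_cdf_def)
  next
    case y: False
    have "- ((1 - p) / l) * ln ((1 - v) / (1 - p)) \<le> y \<longleftrightarrow> - l * y / (1 - p) \<le> ln ((1 - v) / (1 - p))"
      using assms p by (simp add: field_simps)
    also have "\<dots> \<longleftrightarrow> exp (- l * y / (1 - p)) \<le> (1 - v) / (1 - p)"
      using assms p by (simp add: ln_ge_iff)
    also have "\<dots> \<longleftrightarrow> v \<le> 1 - (1 - p) * exp (- l * y / (1 - p))"
      using p by (simp add: field_simps)
    finally show ?thesis using y by (simp add: q laplace_cdf_def)
  qed
qed

text \<open>With \<^term>\<open>p\<close> the mass to the left of \<open>x0\<close>, the exponential bounds on both sides of \<open>x0\<close> say, after
  taking logarithms, that the monotone map carrying the law to the asymmetric Laplace law with peak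
  \<^term>\<open>l\<close> moves no two points closer together.\<close>

lemma (in log_concave_law) laplace_transport_expands:
  obtains p where "0 \<le> p" "p \<le> 1"
    "\<And>x y. x \<le> y \<Longrightarrow> 0 < F x \<Longrightarrow> F y < 1 \<Longrightarrow> y - x \<le> laplace_quantile l p (F y) - laplace_quantile l p (F x)"
proof -
  obtain X x0 where X: "X \<longlonglongrightarrow> x0" "\<And>n. l - l / (real n + 2) < f (X n)"
    using sequence_approaching_level by blast
  define p where "p = F x0"
  define q where "q = laplace_quantile l p"
  have p: "0 \<le> p" "p \<le> 1" by (simp_all add: p_def cdf_nonneg cdf_bounded_prob)
  have q_left: "q (F x) = p / l * ln (F x / p)" if "x \<le> x0" for x
    using cdf_nondecreasing[OF that] by (simp add: q_def p_def laplace_quantile_def)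
  \<comment> \<open>Where \<open>F x = p\<close>, both branches of the quantile function give 0.\<close>
  have q_right: "q (F x) = - ((1 - p) / l) * ln ((1 - F x) / (1 - p))" if "x0 \<le> x" "0 < F x" "F x < 1" for x
  proof (cases "F x = p")
    case True
    then show ?thesis using that by (simp add: q_def laplace_quantile_def)
  next
    case False
    then show ?thesis using cdf_nondecreasing[OF that(1)]
      by (simp add: q_def p_def laplace_quantile_def)
  qed
  have left: "y - x \<le> q (F y) - q (F x)" if "x \<le> y" "y \<le> x0" "0 < F x" for x y
  proof -
    have pos: "0 < F y" "0 < p"
      using that cdf_nondecreasing[of x y] cdf_nondecreasing[of y x0] by (auto simp: p_def)
    have "ln (F x * exp (l / p * (y - x))) \<le> ln (F y)"
      using F_exp_growth[OF X that(1,2)] that pos by (simp add: p_def)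
    then have "l / p * (y - x) \<le> ln (F y) - ln (F x)" using that by (simp add: ln_mult)
    then have "p / l * (l / p * (y - x)) \<le> p / l * (ln (F y) - ln (F x))"
      using pos l_pos by (intro mult_left_mono) auto
    then show ?thesis using that pos l_pos
      by (simp add: q_left ln_div right_diff_distrib)
  qed
  have right: "y - x \<le> q (F y) - q (F x)" if "x0 \<le> x" "x \<le> y" "0 < F x" "F y < 1" for x y
  proof -
    have pos: "F x < 1" "p < 1" "0 < F y"
      using that cdf_nondecreasing[of x y] cdf_nondecreasing[of x0 x] by (auto simp: p_def)
    have "ln ((1 - F y) * exp (l / (1 - p) * (y - x))) \<le> ln (1 - F x)"
      using survival_exp_decay[OF X that(1,2)] that pos by (simp add: p_def)
    then have "l / (1 - p) * (y - x) \<le> ln (1 - F x) - ln (1 - F y)" using that by (simp add: ln_mult)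
    then have "(1 - p) / l * (l / (1 - p) * (y - x)) \<le> (1 - p) / l * (ln (1 - F x) - ln (1 - F y))"
      using pos l_pos by (intro mult_left_mono) auto
    then show ?thesis using that pos l_pos
      by (simp add: q_right ln_div right_diff_distrib)
  qed
  have "y - x \<le> q (F y) - q (F x)" if "x \<le> y" "0 < F x" "F y < 1" for x y
  proof -
    consider "y \<le> x0" | "x0 \<le> x" | "x < x0" "x0 < y" by linarith
    then show ?thesis
    proof cases
      case 3
      have "0 < F x0" using that 3 cdf_nondecreasing[of x x0] by simp
      then have "x0 - x \<le> q (F x0) - q (F x)" "y - x0 \<le> q (F y) - q (F x0)"
        using 3 that by (auto intro: left right)
      then show ?thesis by linarith
    qed (use that in \<open>auto intro: left right\<close>)
  qed
  with p that show ?thesis by (simp add: q_def)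
qed

context real_distribution
begin

lemma cdf_attains:
  assumes cont: "\<And>x. isCont (cdf M) x" and v: "0 < v" "v < 1"
  obtains x where "cdf M x = v"
proof -
  obtain a where a: "cdf M a < v"
    using order_tendstoD(2)[OF cdf_lim_at_bot v(1)] by (auto simp: eventually_at_bot_linorder)
  obtain b where b: "v < cdf M b"
    using order_tendstoD(1)[OF cdf_lim_at_top_prob v(2)] by (auto simp: eventually_at_top_linorder)
  have "a \<le> b" using a b cdf_nondecreasing[of b a] by linarith
  with IVT[of "cdf M" a v b] a b cont that show ?thesis by auto
qed

lemma borel_measurable_cdf: "cdf M \<in> borel_measurable borel"
  by (rule borel_measurable_mono) (simp add: mono_def cdf_nondecreasing)

text \<open>The probability integral transform.\<close>

lemma prob_cdf_le:
  assumes cont: "\<And>x. isCont (cdf M) x" and v: "0 \<le> v" "v \<le> 1"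
  shows "prob {x. cdf M x \<le> v} = v"
proof (rule antisym)
  note borel_measurable_cdf[measurable]
  show "prob {x. cdf M x \<le> v} \<le> v"
  proof (cases "v = 1")
    case False
    show ?thesis
    proof (rule dense_ge_bounded[of v 1])
      fix w assume w: "v < w" "w < 1"
      then have "0 < w" using v by linarith
      then obtain x where "cdf M x = w" using cdf_attains[OF cont] w(2) by blast
      have "y \<le> x" if "cdf M y \<le> v" for y
        using cdf_nondecreasing[of x y] that w \<open>cdf M x = w\<close> by linarith
      then have "prob {x. cdf M x \<le> v} \<le> prob {..x}" by (intro finite_measure_mono) auto
      then show "prob {x. cdf M x \<le> v} \<le> w" using \<open>cdf M x = w\<close> by (simp add: cdf_def)
    qed (use False v in simp)
  qed simp
  consider "v = 0" | "v = 1" | "0 < v" "v < 1" using v by linarith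
  then show "v \<le> prob {x. cdf M x \<le> v}"
  proof cases
    case 2
    then have "{x. cdf M x \<le> v} = space M" by (simp add: cdf_bounded_prob)
    with 2 show ?thesis by (simp add: prob_space del: space_eq_univ)
  next
    case 3
    then obtain x where x: "cdf M x = v" using cdf_attains[OF cont] by blast
    have "prob {..x} \<le> prob {x. cdf M x \<le> v}"
      using x cdf_nondecreasing by (intro finite_measure_mono) auto
    with x show ?thesis by (simp add: cdf_def)
  qed simp
qed

lemma AE_cdf_between:
  assumes cont: "\<And>x. isCont (cdf M) x"
  shows "AE x in M. 0 < cdf M x \<and> cdf M x < 1"
proof -
  note borel_measurable_cdf[measurable]
  have "prob {x. cdf M x \<le> 0} = 0" by (rule prob_cdf_le[OF cont]) auto
  then have "AE x in M. \<not> cdf M x \<le> 0"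
    by (subst AE_iff_measurable[OF _ refl]) (auto simp: emeasure_eq_measure)
  moreover have "prob {x. cdf M x < 1} = 1"
  proof (rule antisym)
    show "1 \<le> prob {x. cdf M x < 1}"
    proof (rule dense_le_bounded[of 0 1])
      fix w :: real assume w: "0 < w" "w < 1"
      have "w = prob {x. cdf M x \<le> w}" using w by (intro prob_cdf_le[symmetric] cont) auto
      also have "\<dots> \<le> prob {x. cdf M x < 1}" using w by (intro finite_measure_mono) auto
      finally show "w \<le> prob {x. cdf M x < 1}" .
    qed simp
  qed simp
  then have "AE x in M. x \<in> {x. cdf M x < 1}"
    by (intro AE_prob_1) simp
  ultimately show ?thesis by eventually_elim simp
qed

end

lemma borel_measurable_laplace_quantile[measurable]: "laplace_quantile l p \<in> borel_measurable borel"
  unfolding laplace_quantile_def by measurable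

lemma (in log_concave_law) cdf_laplace_transport:
  assumes p: "0 \<le> p" "p \<le> 1"
  shows "cdf (distr \<nu> borel (\<lambda>x. laplace_quantile l p (F x))) y = laplace_cdf l p y"
proof -
  note borel_measurable_cdf[measurable]
  have G: "0 \<le> laplace_cdf l p y" "laplace_cdf l p y \<le> 1"
  proof -
    have "(1 - p) * exp (- l * y / (1 - p)) \<le> 1 * 1" if "0 \<le> y"
      using p l_pos that by (intro mult_mono) auto
    moreover have "p * exp (l * y / p) \<le> 1 * 1" if "y < 0"
      using p l_pos that by (intro mult_mono) (auto simp: divide_nonpos_nonneg mult_nonneg_nonpos)
    ultimately show "0 \<le> laplace_cdf l p y" "laplace_cdf l p y \<le> 1"
      using p by (auto simp: laplace_cdf_def)
  qed
  have "cdf (distr \<nu> borel (\<lambda>x. laplace_quantile l p (F x))) y = measure \<nu> {x. laplace_quantile l p (F x) \<le> y}"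
    by (subst cdf_def2, subst measure_distr) (simp_all add: vimage_def)
  also have "\<dots> = measure \<nu> {x. F x \<le> laplace_cdf l p y}"
  proof (rule finite_measure_eq_AE)
    show "AE x in \<nu>. (x \<in> {x. laplace_quantile l p (F x) \<le> y}) = (x \<in> {x. F x \<le> laplace_cdf l p y})"
      using AE_cdf_between[OF isCont_F]
      by eventually_elim (simp add: laplace_quantile_le_iff l_pos p)
  qed measurable
  also have "\<dots> = laplace_cdf l p y" by (rule prob_cdf_le[OF isCont_F G])
  finally show ?thesis .
qed

section \<open>Differences of independent exponential variables\<close>

lemma exponential_law_facts:
  fixes l :: real
  assumes l: "0 < l"
  defines "\<mu> \<equiv> density lborel (\<lambda>x. ennreal (exponential_density l x))"
  shows prob_space_exponential_law: "prob_space \<mu>"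
    and integrable_exponential_law: "integrable \<mu> (\<lambda>x. x)"
    and integral_exponential_law: "(\<integral>x. x \<partial>\<mu>) = 1 / l"
    and AE_exponential_law_pos: "AE x in \<mu>. 0 < x"
    and exponential_law_tail: "0 \<le> y \<Longrightarrow> A = {y<..} \<or> A = {y..} \<Longrightarrow> emeasure \<mu> A = ennreal (exp (- l * y))"
proof -
  show "prob_space \<mu>" unfolding \<mu>_def by (rule prob_space_exponential_density[OF l])
  then interpret prob_space \<mu> .
  have [measurable_cong]: "sets \<mu> = sets borel" by (simp add: \<mu>_def)
  have D: "distributed \<mu> lborel (\<lambda>x. x) (exponential_density l)"
    unfolding distributed_def
  proof (intro conjI)
    show "distr \<mu> lborel (\<lambda>x. x) = density lborel (\<lambda>x. ennreal (exponential_density l x))"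
      unfolding \<mu>_def[symmetric] by (intro distr_id2) (simp add: \<mu>_def)
  qed (simp_all add: \<mu>_def)
  show E: "(\<integral>x. x \<partial>\<mu>) = 1 / l" by (rule exponential_distributed_expectation[OF l D])
  show "integrable \<mu> (\<lambda>x. x)"
    using E l not_integrable_integral_eq[of \<mu> "\<lambda>x. x"] by fastforce
  show "AE x in \<mu>. 0 < x"
    unfolding \<mu>_def using AE_lborel_singleton[of 0]
    by (subst AE_density, simp) (auto elim!: eventually_mono simp: exponential_density_def split: if_splits)
  show "emeasure \<mu> A = ennreal (exp (- l * y))" if "0 \<le> y" "A = {y<..} \<or> A = {y..}"
  proof -
    have "prob A = prob {y<..}"
    proof (rule finite_measure_eq_AE)
      have "AE x in \<mu>. x \<noteq> y"
        unfolding \<mu>_def using AE_lborel_singleton[of y] by (subst AE_density) (auto elim: eventually_mono)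
      then show "AE x in \<mu>. (x \<in> A) = (x \<in> {y<..})"
        by eventually_elim (use that(2) in auto)
    qed (use that in auto)
    also have "\<dots> = exp (- l * y)"
      using exponential_distributedD_gt[OF D that(1) l] by (simp add: \<mu>_def greaterThan_def mult.commute)
    finally show ?thesis by (simp add: emeasure_eq_measure)
  qed
qed

text \<open>For independent exponential variables \<open>W\<close> and \<open>Z\<close> of rate \<^term>\<open>l\<close>, this is the probability of
  \<open>\<alpha> W - \<beta> Z \<in> A\<close>, conditioned on \<open>Z\<close> first. Both kinds of half-line are needed, as the left tail of
  \<open>\<alpha> W - \<beta> Z\<close> is the right tail of \<open>\<beta> Z - \<alpha> W\<close>.\<close>

lemma exponential_difference_tail:
  fixes l :: real
  assumes l: "0 < l" and ab: "0 \<le> \<alpha>" "0 \<le> \<beta>" "\<alpha> + \<beta> = 1"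
    and y: "0 \<le> y" and A: "A = {y<..} \<or> A = {y..}"
  defines "\<mu> \<equiv> density lborel (\<lambda>x. ennreal (exponential_density l x))"
  shows "(\<integral>\<^sup>+z. emeasure \<mu> {w. \<alpha> * w - \<beta> * z \<in> A} \<partial>\<mu>) = ennreal (\<alpha> * exp (- l * y / \<alpha>))"
proof (cases "\<alpha> = 0")
  case True
  have "AE z in \<mu>. emeasure \<mu> {w. \<alpha> * w - \<beta> * z \<in> A} = 0"
    using AE_exponential_law_pos[OF l] unfolding \<mu>_def
  proof eventually_elim
    case (elim z)
    then have "{w. \<alpha> * w - \<beta> * z \<in> A} = {}" using True ab y A by auto
    then show ?case by (simp only: emeasure_empty)
  qed
  then have "(\<integral>\<^sup>+z. emeasure \<mu> {w. \<alpha> * w - \<beta> * z \<in> A} \<partial>\<mu>) = (\<integral>\<^sup>+z. 0 \<partial>\<mu>)"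
    by (rule nn_integral_cong_AE)
  then show ?thesis using True by simp
next
  case False
  then have a: "0 < \<alpha>" using ab by simp
  have la: "0 < l / \<alpha>" using a l by simp
  have "(\<integral>\<^sup>+z. emeasure \<mu> {w. \<alpha> * w - \<beta> * z \<in> A} \<partial>\<mu>) = (\<integral>\<^sup>+z. ennreal (exp (- l * ((y + \<beta> * z) / \<alpha>))) \<partial>\<mu>)"
  proof (rule nn_integral_cong_AE)
    show "AE z in \<mu>. emeasure \<mu> {w. \<alpha> * w - \<beta> * z \<in> A} = ennreal (exp (- l * ((y + \<beta> * z) / \<alpha>)))"
      using AE_exponential_law_pos[OF l] unfolding \<mu>_def
    proof eventually_elim
      case (elim z)
      let ?y = "(y + \<beta> * z) / \<alpha>"
      have "0 \<le> ?y" using elim a ab y by (intro divide_nonneg_pos add_nonneg_nonneg mult_nonneg_nonneg) auto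
      moreover have "{w. \<alpha> * w - \<beta> * z \<in> A} = {?y<..} \<or> {w. \<alpha> * w - \<beta> * z \<in> A} = {?y..}"
        using A a by (auto simp: field_simps)
      ultimately show ?case by (rule exponential_law_tail[OF l])
    qed
  qed
  also have "\<dots> = (\<integral>\<^sup>+z. ennreal (\<alpha> * exp (- l * y / \<alpha>)) * ennreal (exponential_density (l / \<alpha>) z) \<partial>lborel)"
    unfolding \<mu>_def
  proof (subst nn_integral_density; (intro nn_integral_cong)?)
    fix z :: real
    have "- (z * l) + - l * ((y + \<beta> * z) / \<alpha>) = - l * y / \<alpha> + - (z * (l / \<alpha>))"
    proof -
      have "\<beta> = 1 - \<alpha>" using ab by simp
      show ?thesis using a unfolding \<open>\<beta> = 1 - \<alpha>\<close> by (simp add: field_simps)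
    qed
    then have "exp (- (z * l)) * exp (- l * ((y + \<beta> * z) / \<alpha>)) = exp (- l * y / \<alpha>) * exp (- (z * (l / \<alpha>)))"
      unfolding exp_add[symmetric] by (rule arg_cong)
    then have "exponential_density l z * exp (- l * ((y + \<beta> * z) / \<alpha>))
        = \<alpha> * exp (- l * y / \<alpha>) * exponential_density (l / \<alpha>) z"
      using a by (auto simp: exponential_density_def)
    then show "ennreal (exponential_density l z) * ennreal (exp (- l * ((y + \<beta> * z) / \<alpha>)))
        = ennreal (\<alpha> * exp (- l * y / \<alpha>)) * ennreal (exponential_density (l / \<alpha>) z)"
      using a l la by (simp only: ennreal_mult[symmetric] exponential_density_nonneg exp_ge_zero mult_nonneg_nonneg less_imp_le)
  qed simp_all
  also have "\<dots> = ennreal (\<alpha> * exp (- l * y / \<alpha>)) * (\<integral>\<^sup>+z. ennreal (exponential_density (l / \<alpha>) z) \<partial>lborel)"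
    by (rule nn_integral_cmult) simp
  also have "(\<integral>\<^sup>+z. ennreal (exponential_density (l / \<alpha>) z) \<partial>lborel) = 1"
    using prob_space.emeasure_space_1[OF prob_space_exponential_density[OF la]] by (simp add: emeasure_density)
  finally show ?thesis by simp
qed

text \<open>This representation of the asymmetric Laplace law is what makes Jensen's inequality applicable.\<close>

lemma exponential_difference_cdf:
  fixes l p :: real
  assumes l: "0 < l" and p: "0 \<le> p" "p \<le> 1"
  defines "\<mu> \<equiv> density lborel (\<lambda>x. ennreal (exponential_density l x))"
  shows "cdf (distr (\<mu> \<Otimes>\<^sub>M \<mu>) borel (\<lambda>z. (1 - p) * fst z - p * snd z)) y = laplace_cdf l p y"
proof -
  interpret \<mu>: prob_space \<mu> unfolding \<mu>_def by (rule prob_space_exponential_law[OF l])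
  interpret P: pair_prob_space \<mu> \<mu> ..
  have [measurable_cong]: "sets \<mu> = sets borel" by (simp add: \<mu>_def)
  let ?T = "\<lambda>z. (1 - p) * fst z - p * snd z"
  let ?P = "\<mu> \<Otimes>\<^sub>M \<mu>"
  have space: "space ?P = UNIV" by (simp add: space_pair_measure \<mu>_def)
  have cdf: "cdf (distr ?P borel ?T) y = P.prob {z. ?T z \<le> y}"
    by (subst cdf_def2, subst measure_distr) (simp_all add: vimage_def space)
  show ?thesis
  proof (cases "y < 0")
    case True
    have meas: "{z \<in> space ?P. p * snd z - (1 - p) * fst z \<in> {- y..}} \<in> sets ?P" by measurable
    have "{z. ?T z \<le> y} = {z \<in> space ?P. p * snd z - (1 - p) * fst z \<in> {- y..}}"
      by (auto simp: space)
    moreover have "emeasure ?P {z \<in> space ?P. p * snd z - (1 - p) * fst z \<in> {- y..}}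
        = (\<integral>\<^sup>+z. emeasure \<mu> {w. p * w - (1 - p) * z \<in> {- y..}} \<partial>\<mu>)"
      using meas by (subst \<mu>.emeasure_pair_measure_alt) (simp_all add: vimage_def space)
    moreover have "\<dots> = ennreal (p * exp (- l * (- y) / p))"
      unfolding \<mu>_def using True p by (intro exponential_difference_tail l) auto
    ultimately have "P.prob {z. ?T z \<le> y} = p * exp (l * y / p)"
      using p by (simp add: P.emeasure_eq_measure)
    with True cdf show ?thesis by (simp add: laplace_cdf_def)
  next
    case False
    have meas: "{z \<in> space ?P. ?T z \<in> {y<..}} \<in> sets ?P" by measurable
    have "{z. ?T z \<le> y} = space ?P - {z \<in> space ?P. ?T z \<in> {y<..}}"
      by (auto simp: space)
    then have "P.prob {z. ?T z \<le> y} = 1 - P.prob {z \<in> space ?P. ?T z \<in> {y<..}}"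
      by (simp only:) (rule P.prob_compl, measurable)
    moreover have "emeasure ?P {z \<in> space ?P. ?T z \<in> {y<..}}
        = (\<integral>\<^sup>+z. emeasure \<mu> {w. (1 - p) * w - p * z \<in> {y<..}} \<partial>\<mu>)"
      using meas by (subst P.emeasure_pair_measure_alt2) (simp_all add: vimage_def space)
    moreover have "\<dots> = ennreal ((1 - p) * exp (- l * y / (1 - p)))"
      unfolding \<mu>_def using False p by (intro exponential_difference_tail l) auto
    ultimately have "P.prob {z. ?T z \<le> y} = 1 - (1 - p) * exp (- l * y / (1 - p))"
      using p by (simp add: P.emeasure_eq_measure)
    with False cdf show ?thesis by (simp add: laplace_cdf_def)
  qed
qed

lemma (in prob_space) distr_pair_snd:
  assumes "prob_space N"
  shows "distr (N \<Otimes>\<^sub>M M) M snd = M"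
proof (rule measure_eqI)
  interpret N: prob_space N by (rule assms)
  fix A assume "A \<in> sets (distr (N \<Otimes>\<^sub>M M) M snd)"
  then have A: "A \<in> sets M" by simp
  then have "snd -` A \<inter> space (N \<Otimes>\<^sub>M M) = space N \<times> A"
    using sets.sets_into_space[OF A] by (auto simp: space_pair_measure)
  with A show "emeasure (distr (N \<Otimes>\<^sub>M M) M snd) A = emeasure M A"
    by (simp add: emeasure_distr emeasure_pair_measure_Times N.emeasure_space_1)
qed simp

lemma convex_on_real_borel_measurable:
  fixes \<phi> :: "real \<Rightarrow> real"
  assumes "convex_on UNIV \<phi>"
  shows "\<phi> \<in> borel_measurable borel"
  using convex_on_continuous[OF open_UNIV assms] by (rule borel_measurable_continuous_onI)

text \<open>The centered difference is the convex combination \<open>(1 - p) * (W - 1 / l) + p * (- (Z - 1 / l))\<close>. By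
  convexity and evenness of \<^term>\<open>\<phi>\<close>, both terms contribute the same integral as one centered
  exponential variable.\<close>

lemma exponential_difference_moments:
  fixes l p :: real and \<phi> :: "real \<Rightarrow> real"
  assumes l: "0 < l" and p: "0 \<le> p" "p \<le> 1"
  defines "\<mu> \<equiv> density lborel (\<lambda>x. ennreal (exponential_density l x))"
  defines "T \<equiv> \<lambda>z. (1 - p) * fst z - p * snd z"
  shows integrable_exponential_difference: "integrable (\<mu> \<Otimes>\<^sub>M \<mu>) T"
    and centered_exponential_difference_le:
      "convex_on UNIV \<phi> \<Longrightarrow> (\<And>x. \<phi> (- x) = \<phi> x) \<Longrightarrow> (\<And>x. 0 \<le> \<phi> x) \<Longrightarrow>
        (\<integral>\<^sup>+z. ennreal (\<phi> (T z - (\<integral>z. T z \<partial>(\<mu> \<Otimes>\<^sub>M \<mu>)))) \<partial>(\<mu> \<Otimes>\<^sub>M \<mu>)) \<le> (\<integral>\<^sup>+x. ennreal (\<phi> (x - (\<integral>x. x \<partial>\<mu>))) \<partial>\<mu>)"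
proof -
  interpret \<mu>: prob_space \<mu> unfolding \<mu>_def by (rule prob_space_exponential_law[OF l])
  have [measurable_cong]: "sets \<mu> = sets borel" by (simp add: \<mu>_def)
  let ?P = "\<mu> \<Otimes>\<^sub>M \<mu>"
  have int: "integrable \<mu> (\<lambda>x. x)" and mean: "(\<integral>x. x \<partial>\<mu>) = 1 / l"
    unfolding \<mu>_def by (rule integrable_exponential_law[OF l], rule integral_exponential_law[OF l])
  have fst: "distr ?P \<mu> fst = \<mu>" by (rule \<mu>.distr_pair_fst)
  have snd: "distr ?P \<mu> snd = \<mu>" by (rule \<mu>.distr_pair_snd) unfold_locales
  have int_fst: "integrable ?P fst"
    using int integrable_distr[of fst ?P \<mu> "\<lambda>x. x"] by (simp add: fst)
  have int_snd: "integrable ?P snd"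
    using int integrable_distr[of snd ?P \<mu> "\<lambda>x. x"] by (simp add: snd)
  show "integrable ?P T" unfolding T_def using int_fst int_snd by auto
  have "(\<integral>z. fst z \<partial>?P) = 1 / l" "(\<integral>z. snd z \<partial>?P) = 1 / l"
    using integral_distr[of fst ?P \<mu> "\<lambda>x. x"] integral_distr[of snd ?P \<mu> "\<lambda>x. x"]
    by (simp_all add: fst snd mean)
  then have ET: "(\<integral>z. T z \<partial>?P) = (1 - p) * (1 / l) - p * (1 / l)"
    unfolding T_def using int_fst int_snd by simp
  assume \<phi>: "convex_on UNIV \<phi>" "\<And>x. \<phi> (- x) = \<phi> x" "\<And>x. 0 \<le> \<phi> x"
  note [measurable] = convex_on_real_borel_measurable[OF \<phi>(1)]
  have pointwise: "\<phi> (T z - (\<integral>z. T z \<partial>?P)) \<le> (1 - p) * \<phi> (fst z - 1 / l) + p * \<phi> (snd z - 1 / l)" for z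
  proof -
    have "T z - (\<integral>z. T z \<partial>?P) = (1 - p) * (fst z - 1 / l) + p * (- (snd z - 1 / l))"
      unfolding ET by (simp add: T_def algebra_simps)
    also have "\<phi> \<dots> \<le> (1 - p) * \<phi> (fst z - 1 / l) + p * \<phi> (- (snd z - 1 / l))"
      using convex_onD[OF \<phi>(1), of p "fst z - 1 / l" "- (snd z - 1 / l)"] p by simp
    finally show ?thesis by (simp only: \<phi>(2))
  qed
  have "(\<integral>\<^sup>+z. ennreal (\<phi> (T z - (\<integral>z. T z \<partial>?P))) \<partial>?P)
      \<le> (\<integral>\<^sup>+z. ennreal (1 - p) * ennreal (\<phi> (fst z - 1 / l)) + ennreal p * ennreal (\<phi> (snd z - 1 / l)) \<partial>?P)"
    using pointwise p \<phi>(3)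
    by (intro nn_integral_mono) (simp add: ennreal_mult[symmetric] ennreal_plus[symmetric] ennreal_leI del: ennreal_plus)
  also have "\<dots> = ennreal (1 - p) * (\<integral>\<^sup>+z. ennreal (\<phi> (fst z - 1 / l)) \<partial>?P)
      + ennreal p * (\<integral>\<^sup>+z. ennreal (\<phi> (snd z - 1 / l)) \<partial>?P)"
    by (subst nn_integral_add) (simp_all add: nn_integral_cmult)
  also have "(\<integral>\<^sup>+z. ennreal (\<phi> (fst z - 1 / l)) \<partial>?P) = (\<integral>\<^sup>+x. ennreal (\<phi> (x - 1 / l)) \<partial>\<mu>)"
    using nn_integral_distr[of fst ?P \<mu> "\<lambda>x. ennreal (\<phi> (x - 1 / l))"] by (simp add: fst)
  also have "(\<integral>\<^sup>+z. ennreal (\<phi> (snd z - 1 / l)) \<partial>?P) = (\<integral>\<^sup>+x. ennreal (\<phi> (x - 1 / l)) \<partial>\<mu>)"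
    using nn_integral_distr[of snd ?P \<mu> "\<lambda>x. ennreal (\<phi> (x - 1 / l))"] by (simp add: snd)
  also have "ennreal (1 - p) * (\<integral>\<^sup>+x. ennreal (\<phi> (x - 1 / l)) \<partial>\<mu>) + ennreal p * (\<integral>\<^sup>+x. ennreal (\<phi> (x - 1 / l)) \<partial>\<mu>)
      = (\<integral>\<^sup>+x. ennreal (\<phi> (x - 1 / l)) \<partial>\<mu>)"
    using p by (simp add: distrib_right[symmetric] ennreal_plus[symmetric] del: ennreal_plus)
  finally show "(\<integral>\<^sup>+z. ennreal (\<phi> (T z - (\<integral>z. T z \<partial>?P))) \<partial>?P) \<le> (\<integral>\<^sup>+x. ennreal (\<phi> (x - (\<integral>x. x \<partial>\<mu>))) \<partial>\<mu>)"
    by (simp add: mean)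
qed

section \<open>Convex functions of centered variables under expanding maps\<close>

text \<open>Moving away from the contact point of a supporting line, a convex function grows at least as fast
  as the line.\<close>

lemma convex_support_line_increment:
  fixes \<phi> :: "real \<Rightarrow> real"
  assumes \<phi>: "convex_on UNIV \<phi>" and line: "\<And>y. \<phi> u + c * (y - u) \<le> \<phi> y"
    and "x \<in> closed_segment u y"
  shows "c * (y - x) \<le> \<phi> y - \<phi> x"
proof -
  obtain s where s: "0 \<le> s" "s \<le> 1" "x = (1 - s) * u + s * y"
    using assms(3) by (auto simp: closed_segment_def)
  have "\<phi> x \<le> (1 - s) * \<phi> u + s * \<phi> y"
    using convex_onD[OF \<phi>, of s u y] s by simp
  also have "\<dots> \<le> (1 - s) * (\<phi> y - c * (y - u)) + s * \<phi> y"
    using line[of y] s by (intro add_right_mono mult_left_mono) auto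
  also have "\<dots> = \<phi> y - c * (y - x)"
    unfolding s(3) by (simp add: algebra_simps)
  finally show ?thesis by simp
qed

text \<open>The difference \<open>D\<close> of the two centered variables is a nondecreasing function of \<^term>\<open>X\<close> with mean
  zero, so it changes sign once unless it vanishes. If \<open>c\<close> is the slope of a supporting line of \<^term>\<open>\<phi>\<close>
  at the point of sign change, then on both sides of that point the values of \<^term>\<open>\<phi>\<close> at the two
  centered variables differ by at least \<open>c * D\<close>, and the expectation of \<open>c * D\<close> is zero.\<close>

lemma (in prob_space) centered_convex_le_of_expansion:
  fixes X :: "'a \<Rightarrow> real" and r \<phi> :: "real \<Rightarrow> real"
  assumes X: "integrable M X" and rX: "integrable M (\<lambda>\<omega>. r (X \<omega>))"
    and S: "AE \<omega> in M. X \<omega> \<in> S"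
    and expand: "\<And>x y. x \<in> S \<Longrightarrow> y \<in> S \<Longrightarrow> x \<le> y \<Longrightarrow> y - x \<le> r y - r x"
    and \<phi>: "convex_on UNIV \<phi>" "\<And>x. 0 \<le> \<phi> x"
  shows "(\<integral>\<^sup>+\<omega>. ennreal (\<phi> (X \<omega> - expectation X)) \<partial>M)
    \<le> (\<integral>\<^sup>+\<omega>. ennreal (\<phi> (r (X \<omega>) - expectation (\<lambda>\<omega>. r (X \<omega>)))) \<partial>M)"
    (is "(\<integral>\<^sup>+\<omega>. ennreal (\<phi> (?X \<omega>)) \<partial>M) \<le> (\<integral>\<^sup>+\<omega>. ennreal (\<phi> (?Y \<omega>)) \<partial>M)")
proof -
  note [measurable] = convex_on_real_borel_measurable[OF \<phi>(1)] borel_measurable_integrable[OF X] borel_measurable_integrable[OF rX]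
  define D where "D x = (r x - expectation (\<lambda>\<omega>. r (X \<omega>))) - (x - expectation X)" for x
  have D_mono: "D x \<le> D y" if "x \<in> S" "y \<in> S" "x \<le> y" for x y
    using expand[OF that] by (simp add: D_def)
  have D_int: "integrable M (\<lambda>\<omega>. D (X \<omega>))" and D_zero: "expectation (\<lambda>\<omega>. D (X \<omega>)) = 0"
    using X rX by (simp_all add: D_def prob_space)
  have Y: "?Y \<omega> = ?X \<omega> + D (X \<omega>)" for \<omega> by (simp add: D_def)
  \<comment> \<open>If \<open>D\<close> does not change sign, it vanishes almost surely because its mean is zero.\<close>
  consider "\<forall>x\<in>S. 0 \<le> D x" | "\<forall>x\<in>S. D x \<le> 0" | s t where "s \<in> S" "D s < 0" "t \<in> S" "0 < D t"
    by (meson not_le)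
  then show ?thesis
  proof cases
    case 1
    have "AE \<omega> in M. 0 \<le> D (X \<omega>)" using S by eventually_elim (use 1 in auto)
    then have "AE \<omega> in M. D (X \<omega>) = 0"
      using integral_nonneg_eq_0_iff_AE[OF D_int] D_zero by simp
    then have "AE \<omega> in M. ?Y \<omega> = ?X \<omega>" by eventually_elim (simp add: Y)
    then show ?thesis by (intro nn_integral_mono_AE) (auto elim: eventually_mono)
  next
    case 2
    have "AE \<omega> in M. 0 \<le> - D (X \<omega>)" using S by eventually_elim (use 2 in auto)
    then have "AE \<omega> in M. - D (X \<omega>) = 0"
      using integral_nonneg_eq_0_iff_AE[of M "\<lambda>\<omega>. - D (X \<omega>)"] D_int D_zero by simp
    then have "AE \<omega> in M. ?Y \<omega> = ?X \<omega>" by eventually_elim (simp add: Y)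
    then show ?thesis by (intro nn_integral_mono_AE) (auto elim: eventually_mono)
  next
    case (3 s t)
    define w where "w = Sup {x \<in> S. D x < 0}"
    have bdd: "bdd_above {x \<in> S. D x < 0}"
      using 3 D_mono[of t] by (intro bdd_aboveI[of _ t]) (force simp: not_le[symmetric])
    \<comment> \<open>By monotonicity of \<open>D\<close>, the sign changes at \<open>w\<close>.\<close>
    have neg: "D x < 0" if x: "x \<in> S" "x < w" for x
    proof -
      obtain y where "y \<in> S" "D y < 0" "x < y"
        using x less_cSup_iff[OF _ bdd, of x] 3 unfolding w_def by auto
      with D_mono[of x y] x show ?thesis by simp
    qed
    have nonneg: "0 \<le> D x" if "x \<in> S" "w < x" for x
      using cSup_upper[OF _ bdd, of x] that unfolding w_def by (force simp: not_le[symmetric])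
    define u where "u = w - expectation X"
    obtain c where line: "\<And>y. \<phi> u + c * (y - u) \<le> \<phi> y"
      using convex_le_Inf_differential[OF \<phi>(1), of u] by auto
    have below: "c * D x \<le> \<phi> (x - expectation X + D x) - \<phi> (x - expectation X)" if "x \<in> S" for x
    proof -
      \<comment> \<open>At \<open>x = w\<close> the sign of \<open>D\<close> is unknown, but there \<open>x - expectation X\<close> is the contact point \<open>u\<close>.\<close>
      have "x - expectation X \<in> closed_segment u (x - expectation X + D x)"
        using neg[OF that] nonneg[OF that] unfolding u_def
        by (cases x w rule: linorder_cases) (auto simp: closed_segment_eq_real_ivl)
      from convex_support_line_increment[OF \<phi>(1) line this] show ?thesis by simp
    qed
    have le: "AE \<omega> in M. \<phi> (?X \<omega>) \<le> \<phi> (?Y \<omega>) - c * D (X \<omega>)"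
      using S by eventually_elim (use below in \<open>force simp: Y\<close>)
    show ?thesis
    proof (cases "(\<integral>\<^sup>+\<omega>. ennreal (\<phi> (?Y \<omega>)) \<partial>M) = \<infinity>")
      case False
      then have iY: "integrable M (\<lambda>\<omega>. \<phi> (?Y \<omega>))"
        using \<phi>(2) by (intro integrableI_bounded) (auto simp: less_top)
      have iX: "integrable M (\<lambda>\<omega>. \<phi> (?X \<omega>))"
      proof (rule Bochner_Integration.integrable_bound)
        show "integrable M (\<lambda>\<omega>. \<phi> (?Y \<omega>) - c * D (X \<omega>))" using iY D_int by auto
        show "AE \<omega> in M. norm (\<phi> (?X \<omega>)) \<le> norm (\<phi> (?Y \<omega>) - c * D (X \<omega>))"
          using le by eventually_elim (use \<phi>(2) in \<open>auto intro: order_trans[OF _ abs_ge_self]\<close>)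
      qed simp
      have "expectation (\<lambda>\<omega>. \<phi> (?X \<omega>)) \<le> expectation (\<lambda>\<omega>. \<phi> (?Y \<omega>) - c * D (X \<omega>))"
        using iX iY D_int le by (intro integral_mono_AE) auto
      also have "\<dots> = expectation (\<lambda>\<omega>. \<phi> (?Y \<omega>))"
        using iY D_int D_zero by simp
      finally show ?thesis
        using iX iY \<phi>(2) by (simp add: nn_integral_eq_integral)
    qed simp
  qed
qed

lemma (in log_concave_law) centered_integral_le_exponential:
  assumes \<phi>: "convex_on UNIV \<phi>" "\<And>x. \<phi> (- x) = \<phi> x" "\<And>x. 0 \<le> \<phi> x"
  defines "\<mu> \<equiv> density lborel (\<lambda>x. ennreal (exponential_density l x))"
  shows "(\<integral>\<^sup>+x. ennreal (\<phi> (x - (\<integral>x. x \<partial>\<nu>))) \<partial>\<nu>) \<le> (\<integral>\<^sup>+x. ennreal (\<phi> (x - (\<integral>x. x \<partial>\<mu>))) \<partial>\<mu>)"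
proof -
  note [measurable] = borel_measurable_cdf convex_on_real_borel_measurable[OF \<phi>(1)]
  obtain p where p: "0 \<le> p" "p \<le> 1"
    and expand: "\<And>x y. x \<le> y \<Longrightarrow> 0 < F x \<Longrightarrow> F y < 1 \<Longrightarrow>
      y - x \<le> laplace_quantile l p (F y) - laplace_quantile l p (F x)"
    using laplace_transport_expands by blast
  define r where "r x = laplace_quantile l p (F x)" for x
  define S where "S = {x. 0 < F x \<and> F x < 1}"
  have [measurable]: "r \<in> borel_measurable borel" unfolding r_def by measurable
  have AE_S: "AE x in \<nu>. x \<in> S"
    using AE_cdf_between[OF isCont_F] by (simp add: S_def)
  have r: "y - x \<le> r y - r x" if "x \<in> S" "y \<in> S" "x \<le> y" for x y
    using expand that by (simp add: S_def r_def)
  let ?P = "\<mu> \<Otimes>\<^sub>M \<mu>" and ?T = "\<lambda>z. (1 - p) * fst z - p * snd z"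
  interpret \<mu>: prob_space \<mu> unfolding \<mu>_def by (rule prob_space_exponential_law[OF l_pos])
  interpret P: pair_prob_space \<mu> \<mu> ..
  have [measurable_cong]: "sets \<mu> = sets borel" by (simp add: \<mu>_def)
  have law: "distr \<nu> borel r = distr ?P borel ?T"
  proof (rule cdf_unique)
    show "real_distribution (distr \<nu> borel r)" by (rule real_distribution_distr) simp
    show "real_distribution (distr ?P borel ?T)" by (rule P.real_distribution_distr) simp
    show "cdf (distr \<nu> borel r) = cdf (distr ?P borel ?T)"
      unfolding r_def \<mu>_def
      by (simp add: fun_eq_iff cdf_laplace_transport[OF p] exponential_difference_cdf[OF l_pos p])
  qed
  have int_T: "integrable ?P ?T"
    unfolding \<mu>_def by (rule integrable_exponential_difference[OF l_pos p])
  have int_r: "integrable \<nu> r"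
  proof -
    have "integrable (distr ?P borel ?T) (\<lambda>x. x)" using int_T by (simp add: integrable_distr_eq)
    then have "integrable (distr \<nu> borel r) (\<lambda>x. x)" by (simp only: law)
    then show ?thesis by (simp add: integrable_distr_eq)
  qed
  have int_X: "integrable \<nu> (\<lambda>x. x)"
  proof -
    have "\<exists>s. s \<in> S"
    proof (rule ccontr)
      assume "\<nexists>s. s \<in> S"
      then have "AE x in \<nu>. False" using AE_S by simp
      then show False by simp
    qed
    then obtain s where s: "s \<in> S" ..
    \<comment> \<open>By expansion, \<open>\<bar>x - s\<bar> \<le> \<bar>r x - r s\<bar>\<close>, so integrability transfers from the Laplace law.\<close>
    show ?thesis
    proof (rule Bochner_Integration.integrable_bound)
      show "integrable \<nu> (\<lambda>x. \<bar>r x\<bar> + (\<bar>r s\<bar> + \<bar>s\<bar>))"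
        using int_r by (intro Bochner_Integration.integrable_add integrable_abs) auto
      show "AE x in \<nu>. norm x \<le> norm (\<bar>r x\<bar> + (\<bar>r s\<bar> + \<bar>s\<bar>))"
        using AE_S
      proof eventually_elim
        case (elim x)
        then show ?case using r[OF s, of x] r[OF _ s, of x] by (cases "s \<le> x") auto
      qed
    qed simp
  qed
  have "(\<integral>\<^sup>+x. ennreal (\<phi> (x - (\<integral>x. x \<partial>\<nu>))) \<partial>\<nu>) \<le> (\<integral>\<^sup>+x. ennreal (\<phi> (r x - (\<integral>x. r x \<partial>\<nu>))) \<partial>\<nu>)"
    by (rule centered_convex_le_of_expansion[OF int_X int_r AE_S r \<phi>(1,3)])
  also have "\<dots> = (\<integral>\<^sup>+x. ennreal (\<phi> (x - (\<integral>x. x \<partial>distr \<nu> borel r))) \<partial>distr \<nu> borel r)"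
    by (simp add: nn_integral_distr integral_distr)
  also have "\<dots> = (\<integral>\<^sup>+z. ennreal (\<phi> (?T z - (\<integral>z. ?T z \<partial>?P))) \<partial>?P)"
    unfolding law by (simp add: nn_integral_distr integral_distr)
  also have "\<dots> \<le> (\<integral>\<^sup>+x. ennreal (\<phi> (x - (\<integral>x. x \<partial>\<mu>))) \<partial>\<mu>)"
    unfolding \<mu>_def by (rule centered_exponential_difference_le[OF l_pos p \<phi>])
  finally show ?thesis .
qed

section \<open>Densities and their essential suprema\<close>

text \<open>A bathtub argument: with \<open>J = {c - h..c + h}\<close>, the function \<open>g (x - c) - g h\<close> is at most 0 on \<open>J\<close>, where the
  uniform density \<^term>\<open>m\<close> dominates \<^term>\<open>f\<close>, and at least 0 off \<open>J\<close>, where the uniform density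
  vanishes. The centre \<^term>\<open>c\<close> is arbitrary.\<close>

lemma bounded_density_integral_ge_uniform:
  fixes f g :: "real \<Rightarrow> real"
  assumes [measurable]: "f \<in> borel_measurable borel" "g \<in> borel_measurable borel"
    and f: "\<And>x. 0 \<le> f x" "AE x in lborel. f x \<le> m" "(\<integral>\<^sup>+x. ennreal (f x) \<partial>lborel) = 1"
    and h: "0 < h" "2 * h * m = 1"
    and g: "\<And>x. 0 \<le> g x" "\<And>x y. \<bar>x\<bar> \<le> \<bar>y\<bar> \<Longrightarrow> g x \<le> g y"
  shows "(\<integral>\<^sup>+x. ennreal (m * g x) * indicator {- h..h} x \<partial>lborel) \<le> (\<integral>\<^sup>+x. ennreal (f x * g (x - c)) \<partial>lborel)"
proof -
  let ?in = "indicator {c - h..c + h} :: real \<Rightarrow> real"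
  have m: "0 < m" using h zero_less_mult_pos[of "2 * h" m] by simp
  have "(\<integral>\<^sup>+x. ennreal (m * g x) * indicator {- h..h} x \<partial>lborel)
      = (\<integral>\<^sup>+x. ennreal (m * g (x + - c)) * indicator {- h..h} (x + - c) \<partial>lborel)"
    using nn_integral_real_affine[of "\<lambda>x. ennreal (m * g x) * indicator {- h..h} x" 1 "- c"]
    by (simp add: add.commute)
  also have "\<dots> = (\<integral>\<^sup>+x. ennreal (m * g (x - c) * ?in x) \<partial>lborel)"
    by (intro nn_integral_cong) (auto split: split_indicator)
  finally have J: "(\<integral>\<^sup>+x. ennreal (m * g x) * indicator {- h..h} x \<partial>lborel) = (\<integral>\<^sup>+x. ennreal (m * g (x - c) * ?in x) \<partial>lborel)" .
  have "(\<integral>\<^sup>+x. ennreal (m * g (x - c) * ?in x) \<partial>lborel) + ennreal (g h)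
      = (\<integral>\<^sup>+x. ennreal (m * g (x - c) * ?in x) + ennreal (g h) * ennreal (f x) \<partial>lborel)"
    by (subst nn_integral_add) (simp_all add: nn_integral_cmult f)
  also have "\<dots> \<le> (\<integral>\<^sup>+x. ennreal (f x * g (x - c)) + ennreal (g h * m) * indicator {c - h..c + h} x \<partial>lborel)"
  proof (rule nn_integral_mono_AE)
    show "AE x in lborel. ennreal (m * g (x - c) * ?in x) + ennreal (g h) * ennreal (f x)
        \<le> ennreal (f x * g (x - c)) + ennreal (g h * m) * indicator {c - h..c + h} x"
      using f(2)
    proof eventually_elim
      case (elim x)
      have "m * g (x - c) * ?in x + g h * f x \<le> f x * g (x - c) + g h * m * ?in x"
      proof (cases "x \<in> {c - h..c + h}")
        case True
        then have "g (x - c) \<le> g h" by (intro g) auto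
        then have "0 \<le> (g h - g (x - c)) * (m - f x)" using elim by (intro mult_nonneg_nonneg) auto
        then show ?thesis using True by (simp add: algebra_simps)
      next
        case False
        then have "g h \<le> g (x - c)" using h by (intro g) auto
        then show ?thesis using False f(1)[of x] by (simp add: mult.commute mult_left_mono)
      qed
      moreover have "ennreal (g h * m) * indicator {c - h..c + h} x = ennreal (g h * m * ?in x)"
        by (simp split: split_indicator)
      ultimately show ?case
        using f(1) g(1) m
        by (simp add: ennreal_mult[symmetric] ennreal_plus[symmetric] ennreal_leI del: ennreal_plus)
    qed
  qed
  also have "\<dots> = (\<integral>\<^sup>+x. ennreal (f x * g (x - c)) \<partial>lborel) + ennreal (g h * m) * emeasure lborel {c - h..c + h}"
    by (subst nn_integral_add) (simp_all add: nn_integral_cmult_indicator)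
  also have "ennreal (g h * m) * emeasure lborel {c - h..c + h} = ennreal (g h)"
    using h m g(1)[of h] by (simp add: ennreal_mult[symmetric] mult_ac)
  finally show ?thesis unfolding J by (simp add: ennreal_add_left_cancel_le add.commute)
qed

lemma max_density_eq_esssup:
  assumes "distributed M lborel W g"
  shows "max_density M W = esssup lborel g"
proof -
  have [measurable]: "g \<in> borel_measurable borel" using assms by (simp add: distributed_def)
  have "AE x in lborel. g x = RN_deriv lborel (distr M lborel W) x"
    using assms by (intro sigma_finite_measure.RN_deriv_unique sigma_finite_lborel) (auto simp: distributed_def)
  then have "esssup lborel g = esssup lborel (RN_deriv lborel (distr M lborel W))"
    by (intro esssup_AE_cong) auto
  then show ?thesis by (simp add: max_density_def)
qed

lemma esssup_exponential_density_ge: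
  assumes "0 < l"
  shows "ennreal l \<le> esssup lborel (\<lambda>x. ennreal (exponential_density l x))"
proof (rule dense_ge)
  fix z assume z: "esssup lborel (\<lambda>x. ennreal (exponential_density l x)) < z"
  show "ennreal l \<le> z"
  proof (rule ccontr)
    assume "\<not> ennreal l \<le> z"
    then have "z < ennreal l" by simp
    then obtain c where c: "z = ennreal c" "0 \<le> c" "c < l"
      using assms by (cases z) (auto simp: ennreal_less_iff)
    have "isCont (\<lambda>x. l * exp (- x * l)) 0" by (intro continuous_intros)
    then have "\<forall>\<^sub>F x in at_right 0. c < l * exp (- x * l)"
      using c by (intro order_tendstoD(1)[of _ "l * exp (- 0 * l)"])
        (auto simp: isCont_def filterlim_at_split)
    then obtain d where d: "0 < d" "\<And>x. 0 < x \<Longrightarrow> x < d \<Longrightarrow> c < l * exp (- x * l)"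
      by (auto simp: eventually_at_right_field)
    have "AE x in lborel. ennreal (exponential_density l x) \<le> esssup lborel (\<lambda>x. ennreal (exponential_density l x))"
      by (rule esssup_AE)
    then have "AE x in lborel. x \<notin> {0<..<d}"
    proof eventually_elim
      case (elim x)
      have "ennreal (exponential_density l x) \<le> ennreal c"
        unfolding c(1)[symmetric] using le_less_trans[OF elim z] by (rule less_imp_le)
      then show ?case using d(2)[of x] c by (auto simp: exponential_density_def ennreal_le_iff)
    qed
    then have "emeasure lborel {0<..<d} = 0"
      by (subst (asm) AE_iff_measurable[of "{0<..<d}"]) auto
    then show False using d by simp
  qed
qed

section \<open>Young functions and Orlicz norms\<close>

lemma young_function_nonneg: "young_function \<psi> \<Longrightarrow> 0 \<le> x \<Longrightarrow> 0 \<le> \<psi> x"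
  by (auto simp: young_function_def)

lemma young_function_mono: "young_function \<psi> \<Longrightarrow> 0 \<le> x \<Longrightarrow> x \<le> y \<Longrightarrow> \<psi> x \<le> \<psi> y"
  unfolding young_function_def by (auto dest!: strict_mono_on_imp_mono_on simp: mono_on_def)

lemma convex_young_abs:
  assumes \<psi>: "young_function \<psi>" and t: "0 < t"
  shows "convex_on UNIV (\<lambda>x. \<psi> (\<bar>x\<bar> / t))"
proof (rule convex_onI)
  fix s x y :: real
  assume s: "0 < s" "s < 1"
  have "\<bar>(1 - s) * x + s * y\<bar> / t \<le> ((1 - s) * \<bar>x\<bar> + s * \<bar>y\<bar>) / t"
    using s t by (intro divide_right_mono order_trans[OF abs_triangle_ineq]) (auto simp: abs_mult)
  also have "\<dots> = (1 - s) * (\<bar>x\<bar> / t) + s * (\<bar>y\<bar> / t)" by (simp add: add_divide_distrib)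
  finally have "\<psi> (\<bar>(1 - s) * x + s * y\<bar> / t) \<le> \<psi> ((1 - s) * (\<bar>x\<bar> / t) + s * (\<bar>y\<bar> / t))"
    using t by (intro young_function_mono[OF \<psi>]) auto
  also have "\<dots> \<le> (1 - s) * \<psi> (\<bar>x\<bar> / t) + s * \<psi> (\<bar>y\<bar> / t)"
    using \<psi> convex_onD[of "{0..}" \<psi> s "\<bar>x\<bar> / t" "\<bar>y\<bar> / t"] s t by (simp add: young_function_def)
  finally show "\<psi> (\<bar>(1 - s) *\<^sub>R x + s *\<^sub>R y\<bar> / t) \<le> (1 - s) * \<psi> (\<bar>x\<bar> / t) + s * \<psi> (\<bar>y\<bar> / t)" by simp
qed simp

lemma orlicz_norm_mono:
  assumes "\<And>t. 0 < t \<Longrightarrow> (\<integral>\<^sup>+\<omega>. ennreal (\<psi> (\<bar>V \<omega>\<bar> / t)) \<partial>M) \<le> (\<integral>\<^sup>+\<omega>. ennreal (\<psi> (\<bar>W \<omega>\<bar> / t)) \<partial>N)"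
  shows "orlicz_norm \<psi> M V \<le> orlicz_norm \<psi> N W"
  unfolding orlicz_norm_def by (rule Inf_superset_mono) (use assms in \<open>blast intro: order_trans\<close>)

lemma centered_nn_integral_law:
  assumes W: "distributed M lborel W g" and [measurable]: "\<phi> \<in> borel_measurable borel"
  shows "(\<integral>\<^sup>+\<omega>. ennreal (\<phi> (W \<omega> - (\<integral>\<omega>. W \<omega> \<partial>M))) \<partial>M)
    = (\<integral>\<^sup>+x. ennreal (\<phi> (x - (\<integral>x. x \<partial>density lborel g))) \<partial>density lborel g)"
proof -
  have [measurable]: "W \<in> borel_measurable M" using W by (simp add: distributed_def)
  have "density lborel g = distr M lborel W" using W by (simp add: distributed_def)
  then show ?thesis by (simp add: integral_distr nn_integral_distr)
qed

section \<open>The comparison of Orlicz norms\<close>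

text \<open>The translation by the mean of \<^term>\<open>U\<close> reduces this to the bathtub argument around the mean of \<^term>\<open>X\<close>.\<close>

lemma centered_uniform_le_log_concave:
  fixes U :: "'b \<Rightarrow> real" and X :: "'a \<Rightarrow> real" and \<phi> :: "real \<Rightarrow> real"
  assumes "prob_space M" "prob_space N" and ab: "a < b"
    and DU: "distributed N lborel U (\<lambda>x. ennreal (indicator {a..b} x / measure lborel {a..b}))"
    and DX: "distributed M lborel X (\<lambda>x. ennreal (f x))" and f: "log_concave f"
    and max_eq: "max_density N U = max_density M X"
    and [measurable]: "\<phi> \<in> borel_measurable borel"
    and \<phi>: "\<And>x. 0 \<le> \<phi> x" "\<And>x y. \<bar>x\<bar> \<le> \<bar>y\<bar> \<Longrightarrow> \<phi> x \<le> \<phi> y"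
  shows "(\<integral>\<^sup>+\<omega>. ennreal (\<phi> (U \<omega> - (\<integral>\<omega>. U \<omega> \<partial>N))) \<partial>N) \<le> (\<integral>\<^sup>+\<omega>. ennreal (\<phi> (X \<omega> - (\<integral>\<omega>. X \<omega> \<partial>M))) \<partial>M)"
proof -
  have [measurable]: "f \<in> borel_measurable borel" by (rule borel_measurable_log_concave[OF f])
  define m h where "m = 1 / (b - a)" and "h = (b - a) / 2"
  have mh: "0 < m" "0 < h" "2 * h * m = 1" using ab by (simp_all add: m_def h_def)
  have "esssup lborel (\<lambda>x. ennreal (f x)) = esssup lborel (\<lambda>x. ennreal (indicator {a..b} x / measure lborel {a..b}))"
    using max_eq by (simp only: max_density_eq_esssup[OF DX] max_density_eq_esssup[OF DU])
  also have "\<dots> \<le> ennreal m"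
    using ab by (intro esssup_I) (auto simp: m_def intro!: AE_I2 ennreal_leI split: split_indicator)
  finally have "AE x in lborel. ennreal (f x) \<le> ennreal m"
    using esssup_AE[of "\<lambda>x. ennreal (f x)" lborel] by (auto elim!: eventually_mono intro: order_trans)
  then have f_le: "AE x in lborel. f x \<le> m" using mh by simp
  have "prob_space (distr M lborel X)"
    using assms(1) DX by (intro prob_space.prob_space_distr) (simp_all add: distributed_def)
  then have f_int: "(\<integral>\<^sup>+x. ennreal (f x) \<partial>lborel) = 1"
    using prob_space.emeasure_space_1 DX by (fastforce simp: distributed_def emeasure_density)
  have "(\<integral>\<^sup>+\<omega>. ennreal (\<phi> (U \<omega> - (\<integral>\<omega>. U \<omega> \<partial>N))) \<partial>N)
      = (\<integral>\<^sup>+x. ennreal (indicator {a..b} x / measure lborel {a..b}) * ennreal (\<phi> (x - (a + b) / 2)) \<partial>lborel)"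
    unfolding prob_space.uniform_distributed_expectation[OF assms(2) DU]
    by (subst distributed_nn_integral[OF DU]) simp_all
  also have "\<dots> = (\<integral>\<^sup>+x. ennreal (indicator {a..b} (x + (a + b) / 2) / measure lborel {a..b})
      * ennreal (\<phi> (x + (a + b) / 2 - (a + b) / 2)) \<partial>lborel)"
    by (rule nn_integral_real_shift[symmetric]) simp
  also have "\<dots> = (\<integral>\<^sup>+x. ennreal (m * \<phi> x) * indicator {- h..h} x \<partial>lborel)"
  proof (rule nn_integral_cong)
    fix x
    have "x + (a + b) / 2 \<in> {a..b} \<longleftrightarrow> x \<in> {- h..h}" by (auto simp: h_def field_simps)
    then show "ennreal (indicator {a..b} (x + (a + b) / 2) / measure lborel {a..b})
        * ennreal (\<phi> (x + (a + b) / 2 - (a + b) / 2)) = ennreal (m * \<phi> x) * indicator {- h..h} x"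
      using ab \<phi>(1)[of x] by (simp add: m_def indicator_def ennreal_mult'[symmetric])
  qed
  also have "\<dots> \<le> (\<integral>\<^sup>+x. ennreal (f x * \<phi> (x - (\<integral>\<omega>. X \<omega> \<partial>M))) \<partial>lborel)"
    by (rule bounded_density_integral_ge_uniform) (use f_le f_int mh log_concave_nonneg[OF f] \<phi> in auto)
  also have "\<dots> = (\<integral>\<^sup>+x. ennreal (f x) * ennreal (\<phi> (x - (\<integral>\<omega>. X \<omega> \<partial>M))) \<partial>lborel)"
    using log_concave_nonneg[OF f] \<phi>(1) by (simp add: ennreal_mult)
  also have "\<dots> = (\<integral>\<^sup>+\<omega>. ennreal (\<phi> (X \<omega> - (\<integral>\<omega>. X \<omega> \<partial>M))) \<partial>M)"
    by (rule distributed_nn_integral[OF DX]) simp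
  finally show ?thesis .
qed

text \<open>As a log-concave density may jump down at its mode, the equality of the maximal densities only gives
  points where the density of \<^term>\<open>X\<close> exceeds any given number below \<^term>\<open>l\<close>.\<close>

lemma centered_log_concave_le_exponential:
  fixes Z :: "'b \<Rightarrow> real" and X :: "'a \<Rightarrow> real" and \<phi> :: "real \<Rightarrow> real"
  assumes "prob_space M" and l: "0 < l"
    and DZ: "distributed N lborel Z (\<lambda>x. ennreal (exponential_density l x))"
    and DX: "distributed M lborel X (\<lambda>x. ennreal (f x))" and f: "log_concave f"
    and max_eq: "max_density M X = max_density N Z"
    and \<phi>: "convex_on UNIV \<phi>" "\<And>x. \<phi> (- x) = \<phi> x" "\<And>x. 0 \<le> \<phi> x"
  shows "(\<integral>\<^sup>+\<omega>. ennreal (\<phi> (X \<omega> - (\<integral>\<omega>. X \<omega> \<partial>M))) \<partial>M) \<le> (\<integral>\<^sup>+\<omega>. ennreal (\<phi> (Z \<omega> - (\<integral>\<omega>. Z \<omega> \<partial>N))) \<partial>N)"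
proof -
  note meas = borel_measurable_log_concave[OF f] convex_on_real_borel_measurable[OF \<phi>(1)]
  have prob: "prob_space (density lborel (\<lambda>x. ennreal (f x)))"
    using prob_space.prob_space_distr[OF assms(1), of X lborel] DX by (simp add: distributed_def)
  have "ennreal l \<le> esssup lborel (\<lambda>x. ennreal (exponential_density l x))"
    by (rule esssup_exponential_density_ge[OF l])
  also have "\<dots> = esssup lborel (\<lambda>x. ennreal (f x))"
    using max_eq by (simp only: max_density_eq_esssup[OF DX] max_density_eq_esssup[OF DZ])
  finally have l_le: "ennreal l \<le> esssup lborel (\<lambda>x. ennreal (f x))" .
  have law: "log_concave_law f l"
  proof (rule log_concave_law.intro[OF f prob l])
    fix c assume "c < l"
    show "\<exists>x. c < f x"
    proof (rule ccontr)
      assume "\<nexists>x. c < f x"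
      then have "esssup lborel (\<lambda>x. ennreal (f x)) \<le> ennreal c"
        using meas(1) by (intro esssup_I) (auto simp: not_less ennreal_leI)
      also have "\<dots> < ennreal l" using \<open>c < l\<close> l by (simp add: ennreal_lessI)
      finally show False using l_le by simp
    qed
  qed
  show ?thesis
    unfolding centered_nn_integral_law[OF DX meas(2)] centered_nn_integral_law[OF DZ meas(2)]
    by (rule log_concave_law.centered_integral_le_exponential[OF law \<phi>])
qed

theorem theorem1p2:
  fixes M\<^sub>X :: "'a measure" and M\<^sub>U :: "'b measure" and M\<^sub>Z :: "'c measure"
    and X :: "'a \<Rightarrow> real" and U :: "'b \<Rightarrow> real" and Z :: "'c \<Rightarrow> real"
    and a b l :: real and \<psi> :: "real \<Rightarrow> real"
  assumes "prob_space M\<^sub>X" and "prob_space M\<^sub>U" and "prob_space M\<^sub>Z"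
    and "log_concave_rv M\<^sub>X X"
    and "a < b"
    and "distributed M\<^sub>U lborel U (\<lambda>x. ennreal (indicator {a..b} x / measure lborel {a..b}))"
    and "0 < l"
    and "distributed M\<^sub>Z lborel Z (\<lambda>x. ennreal (exponential_density l x))"
    and "max_density M\<^sub>U U = max_density M\<^sub>X X"
    and "max_density M\<^sub>X X = max_density M\<^sub>Z Z"
    and "young_function \<psi>"
  shows "orlicz_norm \<psi> M\<^sub>U (\<lambda>\<omega>. U \<omega> - (\<integral>\<omega>'. U \<omega>' \<partial>M\<^sub>U))
           \<le> orlicz_norm \<psi> M\<^sub>X (\<lambda>\<omega>. X \<omega> - (\<integral>\<omega>'. X \<omega>' \<partial>M\<^sub>X))
       \<and> orlicz_norm \<psi> M\<^sub>X (\<lambda>\<omega>. X \<omega> - (\<integral>\<omega>'. X \<omega>' \<partial>M\<^sub>X))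
           \<le> orlicz_norm \<psi> M\<^sub>Z (\<lambda>\<omega>. Z \<omega> - (\<integral>\<omega>'. Z \<omega>' \<partial>M\<^sub>Z))"
proof -
  obtain g f where g: "distributed M\<^sub>X lborel X g" and f: "log_concave f" and gf: "AE x in lborel. g x = ennreal (f x)"
    using \<open>log_concave_rv M\<^sub>X X\<close> unfolding log_concave_rv_def by blast
  have DX: "distributed M\<^sub>X lborel X (\<lambda>x. ennreal (f x))"
    using g gf borel_measurable_log_concave[OF f]
    by (subst distributed_cong_density[where g = g]) (auto simp: distributed_def elim: eventually_mono)
  note \<psi> = \<open>young_function \<psi>\<close>
  have convex: "convex_on UNIV (\<lambda>x. \<psi> (\<bar>x\<bar> / t))" and nonneg: "0 \<le> \<psi> (\<bar>x\<bar> / t)"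
    and mono: "\<bar>x\<bar> \<le> \<bar>y\<bar> \<Longrightarrow> \<psi> (\<bar>x\<bar> / t) \<le> \<psi> (\<bar>y\<bar> / t)" if "0 < t" for t x y :: real
    using that by (auto intro!: convex_young_abs[OF \<psi>] young_function_nonneg[OF \<psi>] young_function_mono[OF \<psi>] divide_right_mono)
  show ?thesis
  proof (intro conjI orlicz_norm_mono)
    fix t :: real assume t: "0 < t"
    show "(\<integral>\<^sup>+\<omega>. ennreal (\<psi> (\<bar>U \<omega> - (\<integral>\<omega>'. U \<omega>' \<partial>M\<^sub>U)\<bar> / t)) \<partial>M\<^sub>U)
        \<le> (\<integral>\<^sup>+\<omega>. ennreal (\<psi> (\<bar>X \<omega> - (\<integral>\<omega>'. X \<omega>' \<partial>M\<^sub>X)\<bar> / t)) \<partial>M\<^sub>X)"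
      by (rule centered_uniform_le_log_concave[OF assms(1,2,5,6) DX f assms(9)
          convex_on_real_borel_measurable[OF convex] nonneg mono]) (rule t | assumption)+
    show "(\<integral>\<^sup>+\<omega>. ennreal (\<psi> (\<bar>X \<omega> - (\<integral>\<omega>'. X \<omega>' \<partial>M\<^sub>X)\<bar> / t)) \<partial>M\<^sub>X)
        \<le> (\<integral>\<^sup>+\<omega>. ennreal (\<psi> (\<bar>Z \<omega> - (\<integral>\<omega>'. Z \<omega>' \<partial>M\<^sub>Z)\<bar> / t)) \<partial>M\<^sub>Z)"
      by (rule centered_log_concave_le_exponential[OF assms(1,7,8) DX f assms(10) convex[OF t] _ nonneg[OF t]]) simp
  qed
qed

end
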